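(* For integers $N\ge 0$ and $r\ge 0$ let $D_r(N)$ be the coefficient of $(x-1)^r$ in the Taylor expansion about $x=1$ of $(x-1)^N\prod_{j=1}^N\frac{1}{1-x^j}$ (the singularity at $x=1$ being removable; the expression is $1$ when $N=0$). Then for all integers $N\ge 1$ and $1\le l\le N$, $C_{0,1,l}(N)=D_{N-l}(N)$, and for all integers $N\ge 1$ and $r\ge 0$, $$D_r(N)=-\frac{D_r(N-1)}{N}-\sum_{a=1}^{r}\frac{1}{N}\binom{N}{a+1}D_{r-a}(N).$$
   Context: For each integer $N\ge 1$, the Rademacher coefficients $C_{h,k,l}(N)\in\mathbb{C}$ are the unique numbers satisfying $$\prod_{j=1}^N \frac{1}{1-x^j}=\sum_{k=1}^N\ \sum_{\substack{0\le h<k\\ \gcd(h,k)=1}}\ \sum_{l=1}^{\lfloor N/k\rfloor}\frac{C_{h,k,l}(N)}{(x-e^{2\pi i h/k})^l}.$$ For $k=1$ the only admissible $h$ is $h=0$, and $C_{0,1,l}(N)$ is the coefficient of $(x-1)^{-l}$. Binomial coefficients satisfy $\binom{N}{m}=0$ for $m>N$. *)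

theory Defs
  imports "HOL-Complex_Analysis.Complex_Analysis"
begin

definition rademacher_expansion :: "nat \<Rightarrow> (nat \<Rightarrow> nat \<Rightarrow> nat \<Rightarrow> complex) \<Rightarrow> bool" where
  "rademacher_expansion N C \<longleftrightarrow>
     (\<forall>x::complex. (\<forall>j\<in>{1..N}. x ^ j \<noteq> 1) \<longrightarrow>
        (\<Prod>j=1..N. 1 / (1 - x ^ j)) =
        (\<Sum>k=1..N. \<Sum>h | h < k \<and> coprime h k. \<Sum>l=1..N div k.
           C h k l / (x - exp (2 * of_real pi * \<i> * of_nat h / of_nat k)) ^ l))"

(* The expansion determines C h k l only for indices occurring in the sum; requiring the value 0
   elsewhere makes the family, as a total function, unique. *)
definition rademacher_coeff :: "nat \<Rightarrow> nat \<Rightarrow> nat \<Rightarrow> nat \<Rightarrow> complex" where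
  "rademacher_coeff N = (THE C. rademacher_expansion N C \<and>
     (\<forall>h k l. \<not> (1 \<le> k \<and> k \<le> N \<and> h < k \<and> coprime h k \<and> 1 \<le> l \<and> l \<le> N div k)
        \<longrightarrow> C h k l = 0))"

definition taylor_coeff_D :: "nat \<Rightarrow> nat \<Rightarrow> complex" where
  "taylor_coeff_D r N =
     fps_nth (fps_expansion (remove_sings (\<lambda>x. (x - 1) ^ N * (\<Prod>j=1..N. 1 / (1 - x ^ j)))) 1) r"

end

theory Submission
  imports Defs "HOL-Computational_Algebra.Fundamental_Theorem_Algebra"
begin

text \<open>
  Why the theorem is true. Write the expansion as a sum over all poles. Multiplied by
  \<open>(x - a) ^ m\<close>, where \<open>a\<close> is a pole and \<open>m\<close> the multiplicity allotted to it, the part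
  belonging to \<open>a\<close> becomes a polynomial of degree less than \<open>m\<close> in \<open>x - a\<close>, and the parts
  belonging to the other poles contribute only powers \<open>(x - a) ^ n\<close> with \<open>n \<ge> m\<close>. Hence the
  coefficient of \<open>(x - a) ^ (-l)\<close> is the Taylor coefficient of index \<open>m - l\<close>
  (\<open>partial_fraction_coeff\<close>). At \<open>a = 1\<close>, where \<open>m = N\<close>, this is the identity between
  Rademacher coefficients and the numbers \<open>D\<close>.

  The Rademacher coefficients are defined by a definite description, so that an expansion must be
  shown to exist and to be unique before anything can be said about them. Uniqueness is again
  \<open>partial_fraction_coeff\<close>, applied at every pole. Existence follows by splitting off one pole
  after the other (\<open>partial_fractions_exist\<close>), once it is known that a root of unity of exact
  order \<open>k\<close> is a zero of multiplicity \<open>N div k\<close> of \<open>\<Prod>j=1..N. 1 - x ^ j\<close>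
  (\<open>euler_product_factorization\<close>).

  For the recurrence, substitute \<open>x = 1 + z\<close>. Since
  \<open>1 - (1 + z) ^ j = - z * (\<Sum>i<j. (1 + z) ^ i)\<close>, the powers of \<open>z\<close> cancel, and the Taylor series
  for \<open>N\<close> times the polynomial \<open>\<Sum>i<N. (1 + z) ^ i\<close> is minus the Taylor series for \<open>N - 1\<close>. The
  coefficients of that polynomial are the numbers \<open>N choose (a + 1)\<close>, and comparing coefficients
  gives a convolution identity (\<open>taylor_coeff_D_convolution\<close>) whose term with \<open>a = 0\<close> is
  \<open>N\<close> times the Taylor coefficient sought.
\<close>

section \<open>Partial fractions\<close>

text \<open>
  The tool for reading off Taylor coefficients at a removable singularity: agreement with an analytic
  function on a punctured neighbourhood of \<open>a\<close> is enough, because \<open>remove_sings\<close> then agrees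
  with that function on a full neighbourhood, and all derivatives at \<open>a\<close> coincide.
\<close>
lemma fps_expansion_remove_sings:
  assumes ev: "\<forall>\<^sub>F z in at 0. f (a + z) = g z" and g: "g has_fps_expansion E"
  shows "fps_expansion (remove_sings f) a = E"
proof -
  define h where "h = (\<lambda>x. g (x - a))"
  have h_exp: "(\<lambda>z. h (a + z)) has_fps_expansion E"
    using g by (simp add: h_def)
  hence ana: "h analytic_on {a}"
    by (rule has_fps_expansion_imp_analytic)
  obtain S where S: "open S" "a \<in> S" "h holomorphic_on S"
    using ana by (auto simp: analytic_at)
  have "\<forall>\<^sub>F x in at a. f x = h x"
    using ev by (simp add: at_to_0' [of a] eventually_filtermap h_def add.commute)
  then obtain T where T: "open T" "a \<in> T" "\<And>x. x \<in> T \<Longrightarrow> x \<noteq> a \<Longrightarrow> f x = h x"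
    by (auto simp: eventually_at_topological)
  have eq: "remove_sings f x = h x" if x: "x \<in> S \<inter> T" for x
  proof -
    have "\<forall>\<^sub>F y in at x. y \<in> T - {a}"
    proof (cases "x = a")
      case True
      thus ?thesis using T by (auto simp: eventually_at_topological)
    next
      case False
      thus ?thesis using T x by (intro eventually_at_in_open') auto
    qed
    hence "\<forall>\<^sub>F y in at x. f y = h y"
      by eventually_elim (use T in auto)
    hence "remove_sings f x = remove_sings h x"
      by (rule remove_sings_cong) auto
    also have "\<dots> = h x"
      using S x by (intro remove_sings_at_analytic) (auto simp: analytic_at)
    finally show ?thesis .
  qed
  have "\<forall>\<^sub>F x in nhds a. x \<in> S \<inter> T"
    using S T by (intro eventually_nhds_in_open) auto
  hence "\<forall>\<^sub>F x in nhds a. remove_sings f x = h x"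
    by eventually_elim (rule eq)
  hence "fps_expansion (remove_sings f) a = fps_expansion h a"
    by (rule fps_expansion_cong)
  also have "\<dots> = E"
    using analytic_at_imp_has_fps_expansion [OF ana] h_exp by (rule fps_expansion_unique_complex)
  finally show ?thesis .
qed

text \<open>
  The sum \<open>H\<close> of the parts belonging to the other poles is analytic at \<open>\<rho> i\<close>, so after
  multiplication by \<open>(x - \<rho> i) ^ m i\<close> it does not reach the coefficients of index below \<open>m i\<close>. The
  lemma serves twice: it identifies the coefficients, and it shows that they are determined by \<open>f\<close>.
\<close>
lemma partial_fraction_coeff:
  fixes \<rho> :: "'i \<Rightarrow> complex"
  assumes I: "finite I" "inj_on \<rho> I" "i \<in> I" and l: "1 \<le> l" "l \<le> m i"
    and f: "\<And>x. x \<notin> \<rho> ` I \<Longrightarrow> f x = (\<Sum>j\<in>I. \<Sum>l=1..m j. c j l / (x - \<rho> j) ^ l)"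
  shows "c i l = fps_nth (fps_expansion (remove_sings (\<lambda>x. (x - \<rho> i) ^ m i * f x)) (\<rho> i)) (m i - l)"
proof -
  define a where "a = \<rho> i"
  define H where "H = (\<lambda>x. \<Sum>j\<in>I-{i}. \<Sum>l=1..m j. c j l / (x - \<rho> j) ^ l)"
  define T where "T = fps_expansion H a"
  have ne: "\<rho> j \<noteq> a" if "j \<in> I - {i}" for j
    using that I by (auto simp: a_def inj_on_def)
  have "H analytic_on {a}"
    unfolding H_def by (intro analytic_intros) (use ne in force)
  hence T: "(\<lambda>z. H (a + z)) has_fps_expansion T"
    unfolding T_def by (rule analytic_at_imp_has_fps_expansion)
  define E where "E = (\<Sum>l=1..m i. fps_const (c i l) * fps_X ^ (m i - l)) + fps_X ^ m i * T"
  have g: "(\<lambda>z. (\<Sum>l=1..m i. c i l * z ^ (m i - l)) + z ^ m i * H (a + z)) has_fps_expansion E"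
    unfolding E_def by (intro fps_expansion_intros T)
  have "open (- (\<rho> ` (I - {i})))"
    using I by (intro open_Compl finite_imp_closed) auto
  hence "\<forall>\<^sub>F x in at a. x \<in> - (\<rho> ` (I - {i})) - {a}"
    using ne by (intro eventually_at_in_open) auto
  hence "\<forall>\<^sub>F x in at a. x \<notin> \<rho> ` I"
    by eventually_elim (use I in \<open>auto simp: a_def\<close>)
  hence "\<forall>\<^sub>F z in at 0. a + z \<notin> \<rho> ` I"
    by (simp add: at_to_0' [of a] eventually_filtermap add.commute)
  hence "\<forall>\<^sub>F z in at 0. (a + z - a) ^ m i * f (a + z) =
           (\<Sum>l=1..m i. c i l * z ^ (m i - l)) + z ^ m i * H (a + z)"
  proof eventually_elim
    case (elim z)
    hence z: "z \<noteq> 0" using I by (auto simp: a_def)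
    have "f (a + z) = (\<Sum>l=1..m i. c i l / z ^ l) + H (a + z)"
      unfolding f [OF elim] H_def using I by (subst sum.remove [of _ i]) (auto simp: a_def)
    moreover have "z ^ m i * (\<Sum>l=1..m i. c i l / z ^ l) = (\<Sum>l=1..m i. c i l * z ^ (m i - l))"
      unfolding sum_distrib_left using z by (intro sum.cong) (auto simp: power_diff)
    ultimately show ?case by (simp add: algebra_simps)
  qed
  hence "fps_expansion (remove_sings (\<lambda>x. (x - a) ^ m i * f x)) a = E"
    using g by (rule fps_expansion_remove_sings)
  moreover have "fps_nth E (m i - l) = c i l"
  proof -
    have "fps_nth E (m i - l) = (\<Sum>l'=1..m i. if m i - l = m i - l' then c i l' else 0)"
      using l by (simp add: E_def fps_sum_nth fps_X_power_mult_nth if_distrib cong: if_cong)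
    also have "\<dots> = (\<Sum>l'=1..m i. if l' = l then c i l' else 0)"
      using l by (intro sum.cong) auto
    finally show ?thesis using l by simp
  qed
  ultimately show ?thesis by (simp add: a_def)
qed

text \<open>
  Induction on the total multiplicity. Let \<open>Q\<close> be the part of the denominator coprime to the chosen
  pole \<open>\<rho> i\<close>. The constant \<open>c0\<close> is chosen such that \<open>p - c0 Q\<close> vanishes at \<open>\<rho> i\<close>;
  dividing by the factor \<open>x - \<rho> i\<close> lowers both the multiplicity and the bound on the degree by one,
  and \<open>c0\<close> becomes the coefficient of the highest power at \<open>\<rho> i\<close>. The alternative \<open>p = 0\<close> covers
  an empty denominator.
\<close>
lemma partial_fractions_exist:
  fixes \<rho> :: "'i \<Rightarrow> 'a :: field"
  assumes "finite I" "inj_on \<rho> I" "p = 0 \<or> degree p < (\<Sum>i\<in>I. m i)"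
  shows "\<exists>c. \<forall>x. x \<notin> \<rho> ` I \<longrightarrow>
           poly p x / (\<Prod>i\<in>I. (x - \<rho> i) ^ m i) = (\<Sum>i\<in>I. \<Sum>l=1..m i. c i l / (x - \<rho> i) ^ l)"
  using assms(3)
proof (induction "\<Sum>i\<in>I. m i" arbitrary: m p)
  case 0
  thus ?case by (auto intro!: exI [of _ "\<lambda>_ _. 0"])
next
  case (Suc n)
  have "\<exists>i\<in>I. m i \<noteq> 0"
  proof (rule ccontr)
    assume "\<not> ?thesis"
    hence "(\<Sum>i\<in>I. m i) = 0" by simp
    with Suc.hyps(2) show False by simp
  qed
  then obtain i where i: "i \<in> I" "m i > 0" by auto
  define Q where "Q = (\<Prod>j\<in>I-{i}. [:- \<rho> j, 1:] ^ m j)"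
  have sum_m: "(\<Sum>j\<in>I. m j) = m i + (\<Sum>j\<in>I-{i}. m j)"
    using assms i by (simp add: sum.remove)
  have Q_poly: "poly Q x = (\<Prod>j\<in>I-{i}. (x - \<rho> j) ^ m j)" for x
    by (simp add: Q_def poly_prod)
  have "degree Q \<le> (\<Sum>j\<in>I-{i}. m j)"
    unfolding Q_def by (rule order.trans [OF degree_prod_sum_le]) (use assms in \<open>auto simp: degree_linear_power\<close>)
  hence degQ: "degree Q \<le> n" using sum_m i Suc.hyps(2) by simp
  have Q_nz: "poly Q (\<rho> i) \<noteq> 0"
    unfolding Q_poly using assms i by (auto simp: inj_on_def)
  define c0 where "c0 = poly p (\<rho> i) / poly Q (\<rho> i)"
  have "poly (p - smult c0 Q) (\<rho> i) = 0"
    using Q_nz by (simp add: c0_def)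
  hence "[:- \<rho> i, 1:] dvd p - smult c0 Q"
    by (simp only: poly_eq_0_iff_dvd)
  then obtain p' where p': "p - smult c0 Q = [:- \<rho> i, 1:] * p'"
    by (rule dvdE)
  have "degree p \<le> n" using Suc.prems Suc.hyps(2) by auto
  hence "degree (p - smult c0 Q) \<le> n"
    using degQ by (intro degree_diff_le) (auto intro: order.trans [OF degree_smult_le])
  hence p'_deg: "p' = 0 \<or> degree p' < n"
    unfolding p' by (cases "p' = 0") (auto simp: degree_mult_eq simp del: mult_pCons_left)
  define m' where "m' = m(i := m i - 1)"
  have sum_m': "(\<Sum>j\<in>I. m' j) = n"
  proof -
    have "(\<Sum>j\<in>I. m' j) = m' i + (\<Sum>j\<in>I-{i}. m' j)"
      using assms i by (simp add: sum.remove)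
    also have "(\<Sum>j\<in>I-{i}. m' j) = (\<Sum>j\<in>I-{i}. m j)"
      by (intro sum.cong) (auto simp: m'_def)
    finally show ?thesis using sum_m Suc.hyps(2) i by (simp add: m'_def)
  qed
  obtain c' where c': "\<And>x. x \<notin> \<rho> ` I \<Longrightarrow>
      poly p' x / (\<Prod>j\<in>I. (x - \<rho> j) ^ m' j) = (\<Sum>j\<in>I. \<Sum>l=1..m' j. c' j l / (x - \<rho> j) ^ l)"
    using Suc.hyps(1) [of m' p'] sum_m' p'_deg by auto
  define c where "c = (\<lambda>j l. if j = i \<and> l = m i then c0 else c' j l)"
  show ?case
  proof (intro exI [of _ c] allI impI)
    fix x assume x: "x \<notin> \<rho> ` I"
    define u where "u = x - \<rho> i"
    have u: "u \<noteq> 0" using x i by (auto simp: u_def)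
    have Qx: "poly Q x \<noteq> 0" using x assms by (auto simp: Q_poly)
    obtain k where k: "m i = Suc k" using i by (cases "m i") auto
    have D: "(\<Prod>j\<in>I. (x - \<rho> j) ^ m j) = u ^ Suc k * poly Q x"
      using assms i by (simp add: prod.remove Q_poly u_def k)
    have "(\<Prod>j\<in>I. (x - \<rho> j) ^ m' j) = u ^ k * (\<Prod>j\<in>I-{i}. (x - \<rho> j) ^ m' j)"
      using assms i by (simp add: prod.remove u_def k m'_def)
    also have "(\<Prod>j\<in>I-{i}. (x - \<rho> j) ^ m' j) = poly Q x"
      unfolding Q_poly by (intro prod.cong) (auto simp: m'_def)
    finally have D': "(\<Prod>j\<in>I. (x - \<rho> j) ^ m' j) = u ^ k * poly Q x" .
    have "poly p x - c0 * poly Q x = u * poly p' x"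
      using arg_cong [OF p', of "\<lambda>q. poly q x"] by (simp add: u_def algebra_simps)
    hence px: "poly p x = c0 * poly Q x + u * poly p' x" by (simp add: algebra_simps)
    have "poly p x / (\<Prod>j\<in>I. (x - \<rho> j) ^ m j) = c0 / u ^ Suc k + poly p' x / (u ^ k * poly Q x)"
      unfolding D px using u Qx by (simp add: field_simps)
    also have "\<dots> = c0 / u ^ Suc k + (\<Sum>j\<in>I. \<Sum>l=1..m' j. c' j l / (x - \<rho> j) ^ l)"
      using c' [OF x] D' by simp
    also have "(\<Sum>j\<in>I. \<Sum>l=1..m' j. c' j l / (x - \<rho> j) ^ l) =
        (\<Sum>l=1..k. c' i l / u ^ l) + (\<Sum>j\<in>I-{i}. \<Sum>l=1..m' j. c' j l / (x - \<rho> j) ^ l)"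
      using assms i by (simp add: sum.remove m'_def k u_def)
    also have "(\<Sum>l=1..k. c' i l / u ^ l) = (\<Sum>l=1..k. c i l / u ^ l)"
      by (intro sum.cong) (auto simp: c_def k)
    also have "(\<Sum>j\<in>I-{i}. \<Sum>l=1..m' j. c' j l / (x - \<rho> j) ^ l) =
               (\<Sum>j\<in>I-{i}. \<Sum>l=1..m j. c j l / (x - \<rho> j) ^ l)"
      by (intro sum.cong) (auto simp: c_def m'_def)
    also have "c0 / u ^ Suc k + ((\<Sum>l=1..k. c i l / u ^ l) + (\<Sum>j\<in>I-{i}. \<Sum>l=1..m j. c j l / (x - \<rho> j) ^ l))
      = (\<Sum>l=1..Suc k. c i l / u ^ l) + (\<Sum>j\<in>I-{i}. \<Sum>l=1..m j. c j l / (x - \<rho> j) ^ l)"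
      by (simp add: c_def k add_ac)
    also have "\<dots> = (\<Sum>j\<in>I. \<Sum>l=1..m j. c j l / (x - \<rho> j) ^ l)"
      using assms i by (simp add: sum.remove u_def k)
    finally show "poly p x / (\<Prod>j\<in>I. (x - \<rho> j) ^ m j) = (\<Sum>j\<in>I. \<Sum>l=1..m j. c j l / (x - \<rho> j) ^ l)" .
  qed
qed

section \<open>The poles and their multiplicities\<close>

text \<open>
  The pair \<open>(k, h)\<close> stands for the fraction \<open>h / k\<close>; the denominator comes first so that the index
  set is a dependent sum in the order in which the expansion is summed.
\<close>
definition node :: "nat \<times> nat \<Rightarrow> complex" where
  "node = (\<lambda>(k, h). exp (2 * of_real pi * \<i> * of_nat h / of_nat k))"

definition node_index :: "nat \<Rightarrow> (nat \<times> nat) set" where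
  "node_index N = (SIGMA k:{1..N}. {h. h < k \<and> coprime h k})"

lemma node_power_eq_1_iff:
  assumes "(k, h) \<in> node_index N"
  shows "node (k, h) ^ j = 1 \<longleftrightarrow> k dvd j"
proof -
  have kh: "1 \<le> k" "coprime h k" using assms by (auto simp: node_index_def)
  have "node (k, h) ^ j = exp (of_nat j * (2 * of_real pi * \<i> * of_nat h / of_nat k))"
    by (simp only: node_def prod.case exp_of_nat_mult)
  also have "\<dots> = exp (2 * of_real pi * \<i> * of_nat (j * h) / of_nat k)"
    by (simp add: mult_ac)
  finally have "node (k, h) ^ j = 1 \<longleftrightarrow> k dvd j * h"
    using complex_root_unity_eq_1 [OF kh(1), of "j * h"] by simp
  thus ?thesis using kh by (simp add: coprime_dvd_mult_left_iff coprime_commute)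
qed

lemma inj_on_node: "inj_on node (node_index N)"
proof (rule inj_onI, clarify)
  fix k h k' h'
  assume 1: "(k, h) \<in> node_index N" and 2: "(k', h') \<in> node_index N" and eq: "node (k, h) = node (k', h')"
  have "k dvd k'" "k' dvd k"
    using node_power_eq_1_iff [OF 1, of k'] node_power_eq_1_iff [OF 2, of k']
      node_power_eq_1_iff [OF 1, of k] node_power_eq_1_iff [OF 2, of k] eq by simp_all
  hence k: "k' = k" by (simp add: dvd_antisym)
  have "1 \<le> k" "h < k" "h' < k"
    using 1 2 k by (auto simp: node_index_def)
  thus "k = k' \<and> h = h'"
    using eq complex_root_unity_eq [of k h h'] by (simp add: node_def k)
qed

text \<open>
  An arbitrary root of unity \<open>exp (2 \<pi> \<i> n / j)\<close> becomes a node when \<open>n / j\<close> is written in lowest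
  terms; for \<open>n = 0\<close> this gives the index \<open>(1, 0)\<close>.
\<close>
lemma image_node: "node ` node_index N = {z. \<exists>j\<in>{1..N}. z ^ j = 1}"
proof (intro equalityI subsetI)
  fix z assume "z \<in> node ` node_index N"
  then obtain k h where kh: "(k, h) \<in> node_index N" "z = node (k, h)" by auto
  hence "z ^ k = 1" by (simp add: node_power_eq_1_iff)
  thus "z \<in> {z. \<exists>j\<in>{1..N}. z ^ j = 1}" using kh by (auto simp: node_index_def)
next
  fix z :: complex assume "z \<in> {z. \<exists>j\<in>{1..N}. z ^ j = 1}"
  then obtain j where j: "1 \<le> j" "j \<le> N" "z ^ j = 1" by auto
  then obtain n where n: "n < j" and z: "z = exp (2 * of_real pi * \<i> * of_nat n / of_nat j)"
    using complex_roots_unity [OF j(1)] by auto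
  define g where "g = gcd n j"
  have g: "g > 0" using j by (simp add: g_def)
  obtain h k where hk: "n = h * g" "j = k * g" "coprime h k"
    using gcd_coprime_exists [of n j] g unfolding g_def by auto
  have "(k, h) \<in> node_index N"
    using hk n j g by (auto simp: node_index_def intro: order.trans [of k "k * g"])
  moreover have "z = node (k, h)"
    using g by (simp add: z node_def hk field_simps)
  ultimately show "z \<in> node ` node_index N" by blast
qed

lemma card_multiples:
  assumes "k > 0"
  shows "card {j\<in>{1..N}. k dvd j} = N div (k::nat)"
proof -
  have "{j\<in>{1..N}. k dvd j} = (\<lambda>q. k * q) ` {1..N div k}"
  proof (intro equalityI subsetI)
    fix j assume "j \<in> {j\<in>{1..N}. k dvd j}"
    thus "j \<in> (\<lambda>q. k * q) ` {1..N div k}"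
      using assms by (auto simp: less_eq_div_iff_mult_less_eq mult.commute Suc_le_eq elim!: dvdE)
  next
    fix j assume "j \<in> (\<lambda>q. k * q) ` {1..N div k}"
    thus "j \<in> {j\<in>{1..N}. k dvd j}"
      using assms by (auto simp: less_eq_div_iff_mult_less_eq mult.commute Suc_le_eq)
  qed
  also have "card \<dots> = N div k"
    using assms by (subst card_image) (auto simp: inj_on_def)
  finally show ?thesis .
qed

text \<open>
  The product is treated as a polynomial in order to use the factorization of complex polynomials
  according to the orders of their roots.
\<close>
definition euler_poly :: "nat \<Rightarrow> complex poly" where
  "euler_poly N = (\<Prod>j=1..N. 1 - monom 1 j)"

lemma poly_euler_poly: "poly (euler_poly N) x = (\<Prod>j=1..N. 1 - x ^ j)"
  by (simp add: euler_poly_def poly_prod poly_monom)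

text \<open>
  The derivative of \<open>1 - x ^ j\<close> vanishes at most at \<open>0\<close>, which is not a root, so all roots are simple.
\<close>
lemma order_one_minus_monom:
  assumes "j \<ge> 1"
  shows "order z (1 - monom 1 j :: complex poly) = (if z ^ j = 1 then 1 else 0)"
    and "(1 - monom 1 j :: complex poly) \<noteq> 0"
proof -
  let ?p = "1 - monom 1 j :: complex poly"
  show nz: "?p \<noteq> 0"
  proof
    assume "?p = 0"
    hence "poly ?p 0 = 0" by simp
    thus False using assms by (simp add: poly_monom power_0_left)
  qed
  have "rsquarefree ?p"
    using assms by (auto simp: rsquarefree_roots pderiv_diff pderiv_monom poly_monom power_0_left)
  thus "order z ?p = (if z ^ j = 1 then 1 else 0)"
    using nz by (auto simp: rsquarefree_root_order order_0I poly_monom)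
qed

lemma order_euler_poly: "order z (euler_poly N) = card {j\<in>{1..N}. z ^ j = 1}" "euler_poly N \<noteq> 0"
proof -
  have "order z (euler_poly N) = card {j\<in>{1..N}. z ^ j = 1} \<and> euler_poly N \<noteq> 0"
  proof (induction N)
    case 0
    show ?case by (simp add: euler_poly_def)
  next
    case (Suc N)
    let ?q = "1 - monom 1 (Suc N) :: complex poly"
    have eq: "euler_poly (Suc N) = euler_poly N * ?q" by (simp add: euler_poly_def)
    have nz: "euler_poly (Suc N) \<noteq> 0"
      unfolding eq using Suc order_one_minus_monom(2) [of "Suc N"] by simp
    have "{j\<in>{1..Suc N}. z ^ j = 1} =
          (if z ^ Suc N = 1 then insert (Suc N) {j\<in>{1..N}. z ^ j = 1} else {j\<in>{1..N}. z ^ j = 1})"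
      by (auto simp: le_Suc_eq simp del: power_Suc)
    hence "card {j\<in>{1..Suc N}. z ^ j = 1} =
           card {j\<in>{1..N}. z ^ j = 1} + (if z ^ Suc N = 1 then 1 else 0)"
      by (simp del: power_Suc)
    moreover have "order z (euler_poly (Suc N)) = order z (euler_poly N) + order z ?q"
      unfolding eq using nz eq by (intro order_mult) simp
    ultimately show ?case
      using Suc nz order_one_minus_monom(1) [of "Suc N" z] by (simp del: power_Suc)
  qed
  thus "order z (euler_poly N) = card {j\<in>{1..N}. z ^ j = 1}" "euler_poly N \<noteq> 0" by auto
qed

lemma finite_node_index [simp]: "finite (node_index N)"
  by (auto simp: node_index_def)

text \<open>
  The factor \<open>1 - x ^ j\<close> has a simple zero at the node of index \<open>(k, h)\<close> exactly when \<open>k\<close> divides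
  \<open>j\<close>, and \<open>{1..N}\<close> contains \<open>N div k\<close> multiples of \<open>k\<close>.
\<close>
lemma euler_product_factorization:
  obtains c where "c \<noteq> 0"
    "\<And>x. (\<Prod>j=1..N. 1 - x ^ j) = c * (\<Prod>i\<in>node_index N. (x - node i) ^ (N div fst i))"
proof
  let ?c = "lead_coeff (euler_poly N)"
  show "?c \<noteq> 0" using order_euler_poly(2) by simp
  fix x
  have roots: "{z. poly (euler_poly N) z = 0} = node ` node_index N"
    by (auto simp: image_node poly_euler_poly)
  have ord: "order (node i) (euler_poly N) = N div fst i" if "i \<in> node_index N" for i
  proof -
    obtain k h where i: "i = (k, h)" by (cases i)
    have "k > 0" using that by (auto simp: i node_index_def)
    thus ?thesis
      using that card_multiples [of k N] by (simp add: i order_euler_poly node_power_eq_1_iff)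
  qed
  have "euler_poly N = smult ?c (\<Prod>z\<in>node ` node_index N. [:-z, 1:] ^ order z (euler_poly N))"
    using complex_poly_decompose [of "euler_poly N"] unfolding roots by simp
  also have "(\<Prod>z\<in>node ` node_index N. [:-z, 1:] ^ order z (euler_poly N)) =
             (\<Prod>i\<in>node_index N. [:-node i, 1:] ^ (N div fst i))"
    by (subst prod.reindex [OF inj_on_node]) (simp add: ord)
  finally have "poly (euler_poly N) x =
      poly (smult ?c (\<Prod>i\<in>node_index N. [:-node i, 1:] ^ (N div fst i))) x"
    by (rule arg_cong)
  thus "(\<Prod>j=1..N. 1 - x ^ j) = ?c * (\<Prod>i\<in>node_index N. (x - node i) ^ (N div fst i))"
    by (simp add: poly_euler_poly poly_prod)
qed

section \<open>Existence and uniqueness of the Rademacher expansion\<close>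

lemma rademacher_expansion_iff:
  "rademacher_expansion N C \<longleftrightarrow>
     (\<forall>x. x \<notin> node ` node_index N \<longrightarrow> (\<Prod>j=1..N. 1 / (1 - x ^ j)) =
        (\<Sum>i\<in>node_index N. \<Sum>l=1..N div fst i. C (snd i) (fst i) l / (x - node i) ^ l))"
proof -
  have "(\<Sum>i\<in>node_index N. \<Sum>l=1..N div fst i. C (snd i) (fst i) l / (x - node i) ^ l) =
        (\<Sum>k=1..N. \<Sum>h | h < k \<and> coprime h k. \<Sum>l=1..N div k.
           C h k l / (x - exp (2 * of_real pi * \<i> * of_nat h / of_nat k)) ^ l)" for x
    unfolding node_index_def by (subst sum.Sigma) (auto simp: node_def intro!: sum.cong)
  thus ?thesis
    unfolding rademacher_expansion_def image_node by simp
qed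

lemma rademacher_expansion_exists:
  assumes "1 \<le> N"
  shows "\<exists>C. rademacher_expansion N C"
proof -
  obtain c where c: "c \<noteq> 0"
    "\<And>x. (\<Prod>j=1..N. 1 - x ^ j) = c * (\<Prod>i\<in>node_index N. (x - node i) ^ (N div fst i))"
    using euler_product_factorization [of N] by blast
  \<comment> \<open>The pole at \<open>1\<close> alone has multiplicity \<open>N \<ge> 1\<close>, which exceeds the degree of a constant numerator.\<close>
  have "(1, 0) \<in> node_index N" using assms by (simp add: node_index_def)
  hence "N div fst (1::nat, 0::nat) \<le> (\<Sum>i\<in>node_index N. N div fst i)"
    by (intro member_le_sum) auto
  hence "degree [:1 / c:] < (\<Sum>i\<in>node_index N. N div fst i)"
    using assms by simp
  then obtain d where d: "\<And>x. x \<notin> node ` node_index N \<Longrightarrow>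
      poly [:1 / c:] x / (\<Prod>i\<in>node_index N. (x - node i) ^ (N div fst i)) =
      (\<Sum>i\<in>node_index N. \<Sum>l=1..N div fst i. d i l / (x - node i) ^ l)"
    using partial_fractions_exist [OF finite_node_index inj_on_node, of "[:1 / c:]" "\<lambda>i. N div fst i"] by blast
  have "rademacher_expansion N (\<lambda>h k. d (k, h))"
    unfolding rademacher_expansion_iff
  proof (intro allI impI)
    fix x assume x: "x \<notin> node ` node_index N"
    have "(\<Prod>j=1..N. 1 / (1 - x ^ j)) = 1 / (\<Prod>j=1..N. 1 - x ^ j)"
      by (simp add: prod_dividef)
    also have "\<dots> = poly [:1 / c:] x / (\<Prod>i\<in>node_index N. (x - node i) ^ (N div fst i))"
      unfolding c(2) by simp
    also note d [OF x]
    finally show "(\<Prod>j=1..N. 1 / (1 - x ^ j)) =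
        (\<Sum>i\<in>node_index N. \<Sum>l=1..N div fst i. d (fst i, snd i) l / (x - node i) ^ l)"
      by simp
  qed
  thus ?thesis by blast
qed

lemma rademacher_expansion_coeff:
  assumes "rademacher_expansion N C" "(k, h) \<in> node_index N" "1 \<le> l" "l \<le> N div k"
  shows "C h k l = fps_nth (fps_expansion (remove_sings
           (\<lambda>x. (x - node (k, h)) ^ (N div k) * (\<Prod>j=1..N. 1 / (1 - x ^ j)))) (node (k, h))) (N div k - l)"
  using partial_fraction_coeff [OF finite_node_index inj_on_node assms(2),
      of l "\<lambda>i. N div fst i" "\<lambda>x. \<Prod>j=1..N. 1 / (1 - x ^ j)" "\<lambda>i. C (snd i) (fst i)"] assms
  by (simp add: rademacher_expansion_iff)

text \<open>
  An arbitrary expansion is set to \<open>0\<close> at the indices that do not occur in the sum, which leaves the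
  sum unchanged; any competitor then agrees with it at the other indices by
  \<open>rademacher_expansion_coeff\<close>.
\<close>
lemma rademacher_expansion_rademacher_coeff:
  assumes "1 \<le> N"
  shows "rademacher_expansion N (rademacher_coeff N)"
proof -
  define valid where "valid = (\<lambda>h k l. 1 \<le> k \<and> k \<le> N \<and> h < k \<and> coprime h k \<and> 1 \<le> l \<and> l \<le> N div k)"
  have valid: "valid h k l \<longleftrightarrow> (k, h) \<in> node_index N \<and> 1 \<le> l \<and> l \<le> N div k" for h k l
    by (auto simp: valid_def node_index_def)
  obtain C0 where C0: "rademacher_expansion N C0"
    using rademacher_expansion_exists [OF assms] by blast
  define C where "C = (\<lambda>h k l. if valid h k l then C0 h k l else 0)"
  have "(\<Sum>i\<in>node_index N. \<Sum>l=1..N div fst i. C (snd i) (fst i) l / (x - node i) ^ l) =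
        (\<Sum>i\<in>node_index N. \<Sum>l=1..N div fst i. C0 (snd i) (fst i) l / (x - node i) ^ l)" for x
    by (intro sum.cong) (auto simp: C_def valid)
  hence C: "rademacher_expansion N C"
    using C0 by (simp add: rademacher_expansion_iff)
  have "\<exists>!C. rademacher_expansion N C \<and> (\<forall>h k l. \<not> valid h k l \<longrightarrow> C h k l = 0)"
  proof (rule ex1I [of _ C])
    show "rademacher_expansion N C \<and> (\<forall>h k l. \<not> valid h k l \<longrightarrow> C h k l = 0)"
      using C by (simp add: C_def)
    fix C' assume C': "rademacher_expansion N C' \<and> (\<forall>h k l. \<not> valid h k l \<longrightarrow> C' h k l = 0)"
    show "C' = C"
    proof (intro ext)
      fix h k l
      show "C' h k l = C h k l"
      proof (cases "valid h k l")
        case True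
        hence i: "(k, h) \<in> node_index N" "1 \<le> l" "l \<le> N div k"
          by (auto simp: valid)
        show ?thesis
          unfolding rademacher_expansion_coeff [OF C i]
          using C' by (intro rademacher_expansion_coeff i) auto
      next
        case False
        thus ?thesis using C' by (simp add: C_def)
      qed
    qed
  qed
  from theI' [OF this] show ?thesis
    by (simp add: rademacher_coeff_def valid_def)
qed

section \<open>Taylor coefficients at 1\<close>

text \<open>This is \<open>((1 + X) ^ j - 1) / X\<close>, the quotient \<open>(x ^ j - 1) / (x - 1)\<close> written at \<open>x = 1 + X\<close>.\<close>
definition geom_fps :: "nat \<Rightarrow> complex fps" where
  "geom_fps j = (\<Sum>i<j. (1 + fps_X) ^ i)"

lemma geom_fps_nth: "fps_nth (geom_fps j) a = of_nat (j choose (a + 1))"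
proof -
  have "fps_nth (geom_fps j) a = of_nat (\<Sum>i<j. i choose a)"
    by (simp add: geom_fps_def fps_sum_nth fps_binomial_of_nat [symmetric] binomial_gbinomial)
  also have "(\<Sum>i<j. i choose a) = j choose (a + 1)"
    by (cases j) (simp_all add: lessThan_Suc_atMost sum_choose_upper del: binomial_Suc_Suc)
  finally show ?thesis .
qed

text \<open>
  Each of the \<open>N\<close> factors \<open>z = x - 1\<close> cancels the simple zero at \<open>z = 0\<close> of one factor
  \<open>1 - (1 + z) ^ j\<close>; what remains is invertible because its constant coefficient is \<open>\<plusminus>j\<close>.
\<close>
lemma fps_expansion_at_1:
  "fps_expansion (remove_sings (\<lambda>x. (x - 1) ^ N * (\<Prod>j=1..N. 1 / (1 - x ^ j)))) 1 =
     (\<Prod>j=1..N. - inverse (geom_fps j))"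
proof (rule fps_expansion_remove_sings)
  show "(\<lambda>z. \<Prod>j=1..N. - inverse (\<Sum>i<j. (1 + z) ^ i)) has_fps_expansion
          (\<Prod>j=1..N. - inverse (geom_fps j))"
  proof (intro fps_expansion_intros)
    fix j assume j: "j \<in> {1..N}"
    show "(\<lambda>z. \<Sum>i<j. (1 + z) ^ i) has_fps_expansion geom_fps j"
      unfolding geom_fps_def by (intro fps_expansion_intros)
    show "fps_nth (geom_fps j) 0 \<noteq> 0"
      using j by (simp add: geom_fps_nth)
  qed
  have "\<forall>\<^sub>F z in at (0::complex). z \<noteq> 0"
    by (rule eventually_neq_at_within)
  thus "\<forall>\<^sub>F z in at 0. (1 + z - 1) ^ N * (\<Prod>j=1..N. 1 / (1 - (1 + z) ^ j)) =
          (\<Prod>j=1..N. - inverse (\<Sum>i<j. (1 + z) ^ i :: complex))"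
  proof eventually_elim
    case (elim z)
    have "(1 + z - 1) ^ N * (\<Prod>j=1..N. 1 / (1 - (1 + z) ^ j)) = (\<Prod>j=1..N. z * (1 / (1 - (1 + z) ^ j)))"
      unfolding prod.distrib by simp
    also have "\<dots> = (\<Prod>j=1..N. - inverse (\<Sum>i<j. (1 + z) ^ i))"
    proof (intro prod.cong refl)
      fix j
      have "1 - (1 + z) ^ j = - z * (\<Sum>i<j. (1 + z) ^ i)"
        using one_diff_power_eq [of "1 + z" j] by simp
      thus "z * (1 / (1 - (1 + z) ^ j)) = - inverse (\<Sum>i<j. (1 + z) ^ i)"
        using elim by (simp add: divide_simps)
    qed
    finally show ?case .
  qed
qed

lemma taylor_coeff_D_eq: "taylor_coeff_D r N = fps_nth (\<Prod>j=1..N. - inverse (geom_fps j)) r"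
  unfolding taylor_coeff_D_def fps_expansion_at_1 ..

text \<open>
  Multiplying the product of the inverses by \<open>geom_fps N\<close> removes its last factor, up to the sign.
\<close>
lemma taylor_coeff_D_convolution:
  assumes "1 \<le> N"
  shows "(\<Sum>a=0..r. of_nat (N choose (a + 1)) * taylor_coeff_D (r - a) N) = - taylor_coeff_D r (N - 1)"
proof -
  let ?E = "\<lambda>N. \<Prod>j=1..N. - inverse (geom_fps j)"
  obtain M where M: "N = Suc M" using assms by (cases N) auto
  have "geom_fps N * inverse (geom_fps N) = 1"
    using assms by (intro inverse_mult_eq_1') (simp add: geom_fps_nth)
  hence "geom_fps N * ?E N = - ?E (N - 1)"
    by (simp add: M mult.left_commute)
  from arg_cong [OF this, of "\<lambda>F. fps_nth F r"] show ?thesis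
    by (simp add: fps_mult_nth geom_fps_nth taylor_coeff_D_eq)
qed

theorem mainTheorem2:
  shows "(\<forall>N l::nat. 1 \<le> N \<longrightarrow> 1 \<le> l \<longrightarrow> l \<le> N \<longrightarrow>
            rademacher_coeff N 0 1 l = taylor_coeff_D (N - l) N) \<and>
         (\<forall>N r::nat. 1 \<le> N \<longrightarrow>
            taylor_coeff_D r N =
              - (taylor_coeff_D r (N - 1) / of_nat N)
              - (\<Sum>a=1..r. 1 / of_nat N * of_nat (N choose (a + 1)) * taylor_coeff_D (r - a) N))"
proof (intro conjI allI impI)
  fix N l :: nat
  assume N: "1 \<le> N" and l: "1 \<le> l" "l \<le> N"
  have "(1, 0) \<in> node_index N" using N by (simp add: node_index_def)
  from rademacher_expansion_coeff [OF rademacher_expansion_rademacher_coeff [OF N] this, of l] l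
  show "rademacher_coeff N 0 1 l = taylor_coeff_D (N - l) N"
    by (simp add: taylor_coeff_D_def node_def)
next
  fix N r :: nat
  assume N: "1 \<le> N"
  let ?S = "\<Sum>a=1..r. of_nat (N choose (a + 1)) * taylor_coeff_D (r - a) N"
  have "of_nat N * taylor_coeff_D r N + ?S = - taylor_coeff_D r (N - 1)"
    using taylor_coeff_D_convolution [OF N, of r] by (simp add: sum.atLeast_Suc_atMost)
  hence "of_nat N * taylor_coeff_D r N = - taylor_coeff_D r (N - 1) - ?S"
    by (simp add: algebra_simps)
  hence "taylor_coeff_D r N = - (taylor_coeff_D r (N - 1) / of_nat N) - ?S / of_nat N"
    using N by (simp add: field_simps)
  also have "?S / of_nat N =
      (\<Sum>a=1..r. 1 / of_nat N * of_nat (N choose (a + 1)) * taylor_coeff_D (r - a) N)"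
    by (simp add: sum_divide_distrib)
  finally show "taylor_coeff_D r N =
      - (taylor_coeff_D r (N - 1) / of_nat N)
      - (\<Sum>a=1..r. 1 / of_nat N * of_nat (N choose (a + 1)) * taylor_coeff_D (r - a) N)" .
qed

end
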